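(* Let $\mathcal{A}$ be a unital associative algebra, $\Omega=\Omega^0\oplus\Omega^1\oplus\Omega^2$ with $\Omega^0=\mathcal{A}$, and let $(\Omega,\mathrm{d},\bar{\mathrm{d}})$ be a second-order bidifferential calculus. Let $\phi\in\mathcal{A}$ satisfy $$\bar{\mathrm{d}}\phi-(\mathrm{d}\phi)\,\phi=0 .$$ Then $$\mathrm{d}\bar{\mathrm{d}}\phi+(\mathrm{d}\phi)\,(\mathrm{d}\phi)=0 ,$$ and, if $\phi$ is invertible, also $$\mathrm{d}\big[(\bar{\mathrm{d}}\phi)\,\phi^{-1}\big]=0 .$$
   Context: A second-order bidifferential calculus consists of a graded associative algebra $\Omega=\Omega^0\oplus\Omega^1\oplus\Omega^2$ with $\Omega^0=\mathcal{A}$ and $\Omega^1,\Omega^2$ being $\mathcal{A}$-bimodules (products of total degree greater than $2$ are zero), together with linear maps $\mathrm{d},\bar{\mathrm{d}}:\Omega^r\to\Omega^{r+1}$ ($r=0,1$) that satisfy the graded Leibniz rule $\mathrm{d}(\omega\omega')=(\mathrm{d}\omega)\omega'+(-1)^r\omega\,\mathrm{d}\omega'$ for $\omega\in\Omega^r$ (and likewise for $\bar{\mathrm{d}}$), and $\mathrm{d}^2=\bar{\mathrm{d}}^2=\mathrm{d}\bar{\mathrm{d}}+\bar{\mathrm{d}}\mathrm{d}=0$. *)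

theory Defs
  imports Complex_Main
begin

text \<open>
  The sort \<open>{ring, monoid_mult}\<close> is that of unital associative rings; in contrast to
  \<open>ring_1\<close> it does not exclude the zero ring. The ground ring of scalars is an arbitrary
  commutative ring.
\<close>

locale unital_algebra = module scale
  for scale :: "'k::comm_ring_1 \<Rightarrow> 'w::{ring, monoid_mult} \<Rightarrow> 'w" +
  assumes scale_mult_left: "scale c x * y = scale c (x * y)"
    and scale_mult_right: "x * scale c y = scale c (x * y)"

text \<open>
  The graded algebra is the internal direct sum of \<open>\<Omega> 0\<close>, \<open>\<Omega> 1\<close> and \<open>\<Omega> 2\<close>. The degree-zero algebra
  \<open>\<A>\<close> is the unital subalgebra \<open>\<Omega> 0\<close>; associativity of the ambient product and \<open>graded_mult\<close>
  turn \<open>\<Omega> 1\<close> and \<open>\<Omega> 2\<close> into (unital) bimodules over it.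
\<close>

locale graded_algebra_012 = unital_algebra scale
  for scale :: "'k::comm_ring_1 \<Rightarrow> 'w::{ring, monoid_mult} \<Rightarrow> 'w" +
  fixes \<Omega> :: "nat \<Rightarrow> 'w set"
  assumes graded_subspace: "subspace (\<Omega> r)"
    and graded_above: "2 < r \<Longrightarrow> \<Omega> r = {0}"
    and direct_sum: "\<exists>!(a, b, c). a \<in> \<Omega> 0 \<and> b \<in> \<Omega> 1 \<and> c \<in> \<Omega> 2 \<and> x = a + b + c"
    and one_graded: "1 \<in> \<Omega> 0"
    and graded_mult: "\<omega> \<in> \<Omega> r \<Longrightarrow> \<omega>' \<in> \<Omega> s \<Longrightarrow> \<omega> * \<omega>' \<in> \<Omega> (r + s)"

text \<open>
  One function stands for the two maps \<open>\<Omega> 0 \<Rightarrow> \<Omega> 1\<close> and \<open>\<Omega> 1 \<Rightarrow> \<Omega> 2\<close>. Its values on other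
  elements are irrelevant, so the Leibniz rule is restricted to products of total degree at
  most one.
\<close>

locale second_order_calculus = graded_algebra_012 scale \<Omega>
  for scale :: "'k::comm_ring_1 \<Rightarrow> 'w::{ring, monoid_mult} \<Rightarrow> 'w"
    and \<Omega> :: "nat \<Rightarrow> 'w set" +
  fixes d :: "'w \<Rightarrow> 'w"
  assumes d_graded: "r \<le> 1 \<Longrightarrow> \<omega> \<in> \<Omega> r \<Longrightarrow> d \<omega> \<in> \<Omega> (r + 1)"
    and d_add: "r \<le> 1 \<Longrightarrow> \<omega> \<in> \<Omega> r \<Longrightarrow> \<omega>' \<in> \<Omega> r \<Longrightarrow> d (\<omega> + \<omega>') = d \<omega> + d \<omega>'"
    and d_scale: "r \<le> 1 \<Longrightarrow> \<omega> \<in> \<Omega> r \<Longrightarrow> d (scale c \<omega>) = scale c (d \<omega>)"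
    and d_Leibniz: "r + s \<le> 1 \<Longrightarrow> \<omega> \<in> \<Omega> r \<Longrightarrow> \<omega>' \<in> \<Omega> s \<Longrightarrow>
      d (\<omega> * \<omega>') = d \<omega> * \<omega>' + scale ((-1) ^ r) (\<omega> * d \<omega>')"
    and d_d: "a \<in> \<Omega> 0 \<Longrightarrow> d (d a) = 0"

locale second_order_bidifferential_calculus =
  d: second_order_calculus scale \<Omega> d + dbar: second_order_calculus scale \<Omega> dbar
  for scale :: "'k::comm_ring_1 \<Rightarrow> 'w::{ring, monoid_mult} \<Rightarrow> 'w"
    and \<Omega> :: "nat \<Rightarrow> 'w set" and d dbar :: "'w \<Rightarrow> 'w" +
  assumes d_dbar: "a \<in> \<Omega> 0 \<Longrightarrow> d (dbar a) + dbar (d a) = 0"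

end

theory Submission imports Defs begin

text \<open>Apply \<open>d\<close> to \<open>dbar \<phi> = d \<phi> * \<phi>\<close>. Since
  \<open>d \<phi>\<close> has degree one and \<open>d\<close> squares to zero, the Leibniz rule
  leaves only the negative of \<open>d \<phi> * d \<phi>\<close>. Multiplying the same equation on
  the right by the inverse of \<phi> gives \<open>d \<phi>\<close>, which is exact and hence
  closed.\<close>

theorem mainTheorem1:
  fixes scale :: "'k::comm_ring_1 \<Rightarrow> 'w::{ring, monoid_mult} \<Rightarrow> 'w"
    and \<Omega> :: "nat \<Rightarrow> 'w set" and d dbar :: "'w \<Rightarrow> 'w" and \<phi> :: 'w
  assumes "second_order_bidifferential_calculus scale \<Omega> d dbar"
    and "\<phi> \<in> \<Omega> 0"
    and "dbar \<phi> - d \<phi> * \<phi> = 0"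
  shows "d (dbar \<phi>) + d \<phi> * d \<phi> = 0 \<and>
    (\<forall>\<psi> \<in> \<Omega> 0. \<phi> * \<psi> = 1 \<and> \<psi> * \<phi> = 1 \<longrightarrow> d (dbar \<phi> * \<psi>) = 0)"
proof -
  interpret second_order_bidifferential_calculus scale \<Omega> d dbar
    by fact
  have d\<phi>: "d \<phi> \<in> \<Omega> 1"
    using d.d_graded[of 0 \<phi>] assms(2) by simp
  have dbar_\<phi>: "dbar \<phi> = d \<phi> * \<phi>"
    using assms(3) by simp
  \<comment> \<open>The sign stays unevaluated as \<open>(-1) ^ 1\<close>, so that matching reads
    off the degree \<open>r = 1\<close>; \<open>s\<close> is absent from the Leibniz equation and is
    supplied by hand.\<close>
  have "d (d \<phi> * \<phi>) = d (d \<phi>) * \<phi> + scale ((-1) ^ 1) (d \<phi> * d \<phi>)"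
    using d\<phi> assms(2) by (intro d.d_Leibniz[where s = 0]) simp_all
  then have "d (dbar \<phi>) + d \<phi> * d \<phi> = 0"
    using d.d_d[OF assms(2)] dbar_\<phi> by simp
  \<comment> \<open>Associativity collapses \<open>d \<phi> * \<phi> * \<psi>\<close> to
    \<open>d \<phi>\<close> before \<open>d\<close> is applied, so \<psi> is never
    differentiated.\<close>
  moreover have "d (dbar \<phi> * \<psi>) = 0" if "\<phi> * \<psi> = 1" for \<psi>
    using that d.d_d[OF assms(2)] dbar_\<phi> by (simp add: mult.assoc)
  ultimately show ?thesis
    by blast
qed

end
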